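(* Let $\mathcal H$ be a complex Hilbert space, $A$ a positive bounded operator on $\mathcal H$, and let $T_1,T_2,X,Y\in\mathbb B_A(\mathcal H)$. Put $P=\frac{T_1^{*_A}+(T_1^{*_A})^{*_A}}{2}$, $Q=\frac{T_1^{*_A}-(T_1^{*_A})^{*_A}}{2i}$ and $$\alpha=\Big[\omega_A^2(T_1)-\tfrac14\Big(c_A^2(P-Q)+c_A^2(P+Q)+\big|\|P+Q\|_A^2-\|P-Q\|_A^2+c_A^2(P-Q)-c_A^2(P+Q)\big|\Big)\Big]^{1/2}.$$ Then, for either choice of sign, $$\omega_A(T_1XT_2\pm T_2YT_1)\le2\sqrt2\,\|T_2\|_A\max\{\|X\|_A,\|Y\|_A\}\,\alpha.$$
   Context: For a positive bounded operator $A$ on $\mathcal H$: $\langle z,y\rangle_A=\langle Az,y\rangle$, $\|z\|_A=\langle z,z\rangle_A^{1/2}$, $\|S\|_A=\sup\{\|Sz\|_A:\|z\|_A=1\}$, $\omega_A(S)=\sup\{|\langle Sz,z\rangle_A|:\|z\|_A=1\}$ and $c_A(S)=\inf\{|\langle Sz,z\rangle_A|:\|z\|_A=1\}$. $\mathbb B_A(\mathcal H)$ is the set of bounded operators $S$ on $\mathcal H$ admitting an $A$-adjoint, i.e. a bounded $R$ with $AR=S^*A$; then $S^{*_A}=A^\dagger S^*A$ ($A^\dagger$ the Moore–Penrose inverse) is the distinguished one (the unique one with range in $\overline{\mathcal R(A)}$). *)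

theory Defs
  imports "HOL-Analysis.Analysis"
begin

text \<open>The inner product is linear in the first argument.\<close>

class complex_inner = real_normed_vector +
  fixes scaleC :: "complex \<Rightarrow> 'a \<Rightarrow> 'a"  (infixr "*\<^sub>C" 75)
    and cinner :: "'a \<Rightarrow> 'a \<Rightarrow> complex"
  assumes scaleC_add_right: "c *\<^sub>C (x + y) = c *\<^sub>C x + c *\<^sub>C y"
    and scaleC_add_left: "(c + d) *\<^sub>C x = c *\<^sub>C x + d *\<^sub>C x"
    and scaleC_scaleC: "c *\<^sub>C (d *\<^sub>C x) = (c * d) *\<^sub>C x"
    and scaleR_eq_scaleC: "r *\<^sub>R x = complex_of_real r *\<^sub>C x"
    and cinner_commute: "cinner x y = cnj (cinner y x)"
    and cinner_add_left: "cinner (x + y) z = cinner x z + cinner y z"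
    and cinner_scaleC_left: "cinner (c *\<^sub>C x) y = c * cinner x y"
    and cinner_self: "cinner x x = complex_of_real ((norm x)\<^sup>2)"

class chilbert_space = complex_inner + banach

instantiation complex :: chilbert_space
begin

definition scaleC_complex :: "complex \<Rightarrow> complex \<Rightarrow> complex"
  where "scaleC_complex c x = c * x"

definition cinner_complex :: "complex \<Rightarrow> complex \<Rightarrow> complex"
  where "cinner_complex x y = x * cnj y"

instance
  by standard
    (simp_all add: scaleC_complex_def cinner_complex_def algebra_simps scaleR_conv_of_real
      complex_norm_square del: of_real_power)

end

definition bounded_clinear :: "('a::complex_inner \<Rightarrow> 'a) \<Rightarrow> bool"
  where "bounded_clinear S \<longleftrightarrow> bounded_linear S \<and> (\<forall>c x. S (c *\<^sub>C x) = c *\<^sub>C S x)"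

definition cadjoint :: "('a::complex_inner \<Rightarrow> 'a) \<Rightarrow> 'a \<Rightarrow> 'a"
  where "cadjoint S = (THE R. \<forall>x y. cinner (S x) y = cinner x (R y))"

definition positive_op :: "('a::complex_inner \<Rightarrow> 'a) \<Rightarrow> bool"
  where "positive_op A \<longleftrightarrow>
    bounded_clinear A \<and> (\<forall>x. cinner (A x) x \<in> \<real> \<and> 0 \<le> Re (cinner (A x) x))"

definition orth_compl :: "'a::complex_inner set \<Rightarrow> 'a set"
  where "orth_compl M = {x. \<forall>y\<in>M. cinner x y = 0}"

text \<open>
  The Moore--Penrose inverse of \<open>A\<close> is the linear map on \<open>range A + (range A)\<^sup>\<bottom>\<close> that vanishes
  on \<open>(range A)\<^sup>\<bottom>\<close> and inverts the restriction of \<open>A\<close> to \<open>(ker A)\<^sup>\<bottom>\<close>. It is unbounded unless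
  \<open>range A\<close> is closed. Values outside its domain are unspecified.
\<close>

definition moore_penrose :: "('a::complex_inner \<Rightarrow> 'a) \<Rightarrow> 'a \<Rightarrow> 'a"
  where "moore_penrose A y =
    (THE x. x \<in> orth_compl {z. A z = 0} \<and> y - A x \<in> orth_compl (range A))"

definition A_inner :: "('a::complex_inner \<Rightarrow> 'a) \<Rightarrow> 'a \<Rightarrow> 'a \<Rightarrow> complex"
  where "A_inner A z y = cinner (A z) y"

definition A_seminorm :: "('a::complex_inner \<Rightarrow> 'a) \<Rightarrow> 'a \<Rightarrow> real"
  where "A_seminorm A z = sqrt (Re (A_inner A z z))"

definition A_unit :: "('a::complex_inner \<Rightarrow> 'a) \<Rightarrow> 'a set"
  where "A_unit A = {z. A_seminorm A z = 1}"

text \<open>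
  If \<open>A = 0\<close> then \<open>A_unit A\<close> is empty, and the real \<open>Sup\<close> and \<open>Inf\<close> of the empty set are
  unspecified. All three quantities below are \<open>0\<close> in this case. On operators with an
  \<open>A\<close>-adjoint the suprema are over bounded sets.
\<close>

definition A_opnorm :: "('a::complex_inner \<Rightarrow> 'a) \<Rightarrow> ('a \<Rightarrow> 'a) \<Rightarrow> real"
  where "A_opnorm A S =
    (if A_unit A = {} then 0 else SUP z\<in>A_unit A. A_seminorm A (S z))"

definition A_numradius :: "('a::complex_inner \<Rightarrow> 'a) \<Rightarrow> ('a \<Rightarrow> 'a) \<Rightarrow> real"
  where "A_numradius A S =
    (if A_unit A = {} then 0 else SUP z\<in>A_unit A. cmod (A_inner A (S z) z))"

definition A_crawford :: "('a::complex_inner \<Rightarrow> 'a) \<Rightarrow> ('a \<Rightarrow> 'a) \<Rightarrow> real"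
  where "A_crawford A S =
    (if A_unit A = {} then 0 else INF z\<in>A_unit A. cmod (A_inner A (S z) z))"

definition A_adjointable :: "('a::complex_inner \<Rightarrow> 'a) \<Rightarrow> ('a \<Rightarrow> 'a) set"
  where "A_adjointable A =
    {S. bounded_clinear S \<and> (\<exists>R. bounded_clinear R \<and> A \<circ> R = cadjoint S \<circ> A)}"

definition A_adjoint :: "('a::complex_inner \<Rightarrow> 'a) \<Rightarrow> ('a \<Rightarrow> 'a) \<Rightarrow> 'a \<Rightarrow> 'a"
  where "A_adjoint A S = moore_penrose A \<circ> cadjoint S \<circ> A"

end

(*
  For A-unit vectors z, moving T1 and T2 to the right-hand argument and applying Cauchy-Schwarz gives
    |<T1 X T2 z, z>_A| + |<T2 Y T1 z, z>_A|
      <= ||T2||_A max(||X||_A, ||Y||_A) (||T1 z||_A + ||T1* z||_A),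
  and ||T1 z||_A^2 + ||T1* z||_A^2 = ||(P + Q) z||_A^2 + ||(P - Q) z||_A^2. The operators P + Q and
  P - Q are A-self-adjoint, and the squares of their quadratic forms at z sum to 2 |<T1 z, z>_A|^2, so
  both ||P + Q||_A^2 + c_A(P - Q)^2 and ||P - Q||_A^2 + c_A(P + Q)^2 are at most 2 omega_A(T1)^2.
*)

theory Submission imports Defs begin

text \<open>Two obstacles lie outside the estimate itself. The first is that a bounded operator need
  not be bounded for the A-seminorm, which can be far weaker than the norm. The suprema in the
  statement bound individual vectors only once finiteness is known, and this finiteness comes from
  the existence of an A-adjoint. The second is that the distinguished adjoint is defined through the
  possibly unbounded Moore-Penrose inverse. Its linearity and boundedness have to be derived, and
  the double adjoint of T1 equals T1 only modulo ker A. All computations therefore go through the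
  form <., .>_A, which does not see ker A. The combinations P + Q and P - Q come from a rotation by
  45 degrees: with t = <T1 z, z>_A, their forms at z are sqrt 2 times the real and the imaginary
  part of exp(i pi / 4) t.\<close>

lemma cinner_diff_left: "cinner (x - y) z = cinner x z - cinner y (z::'a::complex_inner)"
  by (metis add_diff_cancel cinner_add_left diff_add_cancel)

lemma cinner_zero_left [simp]: "cinner 0 (x::'a::complex_inner) = 0"
  using cinner_diff_left[of x x x] by simp

lemma cinner_add_right: "cinner x (y + z) = cinner x y + cinner x (z::'a::complex_inner)"
  by (metis cinner_add_left cinner_commute complex_cnj_add)

lemma cinner_diff_right: "cinner x (y - z) = cinner x y - cinner x (z::'a::complex_inner)"
  by (metis cinner_diff_left cinner_commute complex_cnj_diff)

lemma cinner_zero_right [simp]: "cinner (x::'a::complex_inner) 0 = 0"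
  using cinner_diff_right[of x x x] by simp

lemma cinner_scaleC_right: "cinner x (c *\<^sub>C y) = cnj c * cinner x (y::'a::complex_inner)"
  by (metis cinner_scaleC_left cinner_commute complex_cnj_mult)

lemma scaleC_zero_right: "c *\<^sub>C 0 = (0::'a::complex_inner)"
  using scaleC_add_right[of c 0 "0::'a"] by simp

lemma cinner_eq_zero_imp: "cinner x x = 0 \<Longrightarrow> (x::'a::complex_inner) = 0"
  by (simp add: cinner_self)

lemma cinner_eqI:
  fixes y z :: "'a::complex_inner"
  assumes "\<And>x. cinner x y = cinner x z"
  shows "y = z"
  using cinner_eq_zero_imp[of "y - z"] assms by (simp add: cinner_diff_right)

lemma bounded_clinearD:
  assumes "bounded_clinear S"
  shows "S (x + y) = S x + S y" "S (x - y) = S x - S y" "S (c *\<^sub>C x) = c *\<^sub>C S x" "S 0 = 0"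
  using assms by (auto simp: bounded_clinear_def linear_simps bounded_linear.linear)

lemma bounded_clinear_bound:
  assumes "bounded_clinear S"
  obtains K where "K > 0" "\<And>x. norm (S x) \<le> norm x * K"
  using assms bounded_linear.pos_bounded by (metis bounded_clinear_def)

lemma bounded_clinear_intro:
  fixes S :: "'a::complex_inner \<Rightarrow> 'a"
  assumes "\<And>x y. S (x + y) = S x + S y" "\<And>c x. S (c *\<^sub>C x) = c *\<^sub>C S x"
    and "\<And>x. norm (S x) \<le> norm x * K"
  shows "bounded_clinear S"
  unfolding bounded_clinear_def
  using assms by (auto intro!: bounded_linear_intro[where K=K] simp: scaleR_eq_scaleC)

lemma bounded_clinear_compose:
  "bounded_clinear S \<Longrightarrow> bounded_clinear R \<Longrightarrow> bounded_clinear (\<lambda>x. S (R x))"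
  by (auto simp: bounded_clinear_def bounded_linear_compose)

lemma bounded_clinear_add:
  "bounded_clinear S \<Longrightarrow> bounded_clinear R \<Longrightarrow> bounded_clinear (\<lambda>x. S x + R x)"
  by (auto simp: bounded_clinear_def bounded_linear_add scaleC_add_right)

lemma bounded_clinear_id: "bounded_clinear (\<lambda>x. x)"
  by (simp add: bounded_clinear_def bounded_linear_ident)

section \<open>The semi-inner product of a positive operator\<close>

context
  fixes A :: "'a::complex_inner \<Rightarrow> 'a"
  assumes pos: "positive_op A"
begin

lemma positive_op_clinear: "bounded_clinear A"
  using pos by (simp add: positive_op_def)

lemma A_inner_add_left: "A_inner A (x + y) z = A_inner A x z + A_inner A y z"
  and A_inner_diff_left: "A_inner A (x - y) z = A_inner A x z - A_inner A y z"
  and A_inner_scaleC_left: "A_inner A (c *\<^sub>C x) z = c * A_inner A x z"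
  and A_inner_add_right: "A_inner A z (x + y) = A_inner A z x + A_inner A z y"
  and A_inner_diff_right: "A_inner A z (x - y) = A_inner A z x - A_inner A z y"
  and A_inner_scaleC_right: "A_inner A z (c *\<^sub>C x) = cnj c * A_inner A z x"
  by (simp_all add: A_inner_def bounded_clinearD[OF positive_op_clinear]
      cinner_add_left cinner_diff_left cinner_scaleC_left
      cinner_add_right cinner_diff_right cinner_scaleC_right)

lemmas A_inner_simps = A_inner_add_left A_inner_diff_left A_inner_scaleC_left
  A_inner_add_right A_inner_diff_right A_inner_scaleC_right

lemma A_inner_self_nonneg: "Im (A_inner A x x) = 0" "Re (A_inner A x x) \<ge> 0"
  using pos by (auto simp: positive_op_def A_inner_def complex_is_Real_iff)

text \<open>Over the complex field a form with real diagonal is Hermitian: the diagonal at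
  \<open>x + y\<close> settles the imaginary parts, the one at \<open>x + \<i> *\<^sub>C y\<close>
  the real parts.\<close>

lemma A_inner_commute: "A_inner A x y = cnj (A_inner A y x)"
proof (rule complex_eqI)
  show "Im (A_inner A x y) = Im (cnj (A_inner A y x))"
    using A_inner_self_nonneg(1)[of "x + y"] A_inner_self_nonneg(1)[of x]
      A_inner_self_nonneg(1)[of y]
    by (simp add: A_inner_simps)
  show "Re (A_inner A x y) = Re (cnj (A_inner A y x))"
    using A_inner_self_nonneg(1)[of "x + \<i> *\<^sub>C y"] A_inner_self_nonneg(1)[of x]
      A_inner_self_nonneg(1)[of y]
    by (simp add: A_inner_simps)
qed

lemma A_seminorm_nonneg: "A_seminorm A x \<ge> 0"
  by (simp add: A_seminorm_def A_inner_self_nonneg)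

lemma A_seminorm_sq: "(A_seminorm A x)\<^sup>2 = Re (A_inner A x x)"
  by (simp add: A_seminorm_def A_inner_self_nonneg)

lemma A_inner_self: "A_inner A x x = complex_of_real ((A_seminorm A x)\<^sup>2)"
  unfolding A_seminorm_sq by (simp add: complex_eq_iff A_inner_self_nonneg)

lemma A_seminorm_scaleC: "A_seminorm A (c *\<^sub>C x) = cmod c * A_seminorm A x"
proof -
  have "complex_of_real ((A_seminorm A (c *\<^sub>C x))\<^sup>2) = complex_of_real ((cmod c * A_seminorm A x)\<^sup>2)"
    unfolding A_inner_self[symmetric] power_mult_distrib of_real_mult complex_norm_square
    by (simp add: A_inner_simps)
  then have "(A_seminorm A (c *\<^sub>C x))\<^sup>2 = (cmod c * A_seminorm A x)\<^sup>2"
    using of_real_eq_iff by blast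
  then show ?thesis
    by (simp add: power2_eq_iff_nonneg A_seminorm_nonneg)
qed

lemma A_seminorm_parallelogram:
  "(A_seminorm A (x + y))\<^sup>2 + (A_seminorm A (x - y))\<^sup>2
     = 2 * ((A_seminorm A x)\<^sup>2 + (A_seminorm A y)\<^sup>2)"
  by (simp add: A_seminorm_sq A_inner_simps)

lemma A_cauchy_schwarz: "cmod (A_inner A x y) \<le> A_seminorm A x * A_seminorm A y"
proof -
  define b where "b = A_inner A x y"
  \<comment> \<open>This is ||x - t b y||_A^2 expanded; the factor \<open>b\<close> makes the cross
    terms real, so a real parameter suffices.\<close>
  have quad: "0 \<le> (A_seminorm A x)\<^sup>2 - 2 * t * (cmod b)\<^sup>2 + t\<^sup>2 * (cmod b)\<^sup>2 * (A_seminorm A y)\<^sup>2" for t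
  proof -
    have yx: "A_inner A y x = cnj b"
      using A_inner_commute b_def by blast
    define c where "c = complex_of_real t * b"
    have "A_inner A (x - c *\<^sub>C y) (x - c *\<^sub>C y)
        = A_inner A x x - cnj c * b - c * cnj b + c * cnj c * A_inner A y y"
      by (simp add: A_inner_simps yx b_def[symmetric] algebra_simps)
    also have "\<dots> = complex_of_real ((A_seminorm A x)\<^sup>2 - 2 * t * (cmod b)\<^sup>2
        + t\<^sup>2 * (cmod b)\<^sup>2 * (A_seminorm A y)\<^sup>2)"
      unfolding A_inner_self of_real_add of_real_diff of_real_mult complex_norm_square c_def
      by (simp add: algebra_simps power2_eq_square)
    finally have "Re (A_inner A (x - c *\<^sub>C y) (x - c *\<^sub>C y))
      = (A_seminorm A x)\<^sup>2 - 2 * t * (cmod b)\<^sup>2 + t\<^sup>2 * (cmod b)\<^sup>2 * (A_seminorm A y)\<^sup>2"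
      by (metis Re_complex_of_real)
    then show ?thesis
      using A_inner_self_nonneg(2) by metis
  qed
  have "(cmod b)\<^sup>2 \<le> (A_seminorm A x * A_seminorm A y)\<^sup>2"
  proof (cases "A_seminorm A y = 0")
    case True
    have "b = 0"
    proof (rule ccontr)
      assume "b \<noteq> 0"
      \<comment> \<open>For an A-null \<open>y\<close> this parameter makes the right-hand side of
        \<open>quad\<close> equal to -1.\<close>
      then show False
        using quad[of "((A_seminorm A x)\<^sup>2 + 1) / (2 * (cmod b)\<^sup>2)"] True by simp
    qed
    then show ?thesis by simp
  next
    case False
    then have "(A_seminorm A y)\<^sup>2 > 0" by simp
    moreover have "0 \<le> (A_seminorm A x)\<^sup>2 - (cmod b)\<^sup>2 / (A_seminorm A y)\<^sup>2"
      using quad[of "1 / (A_seminorm A y)\<^sup>2"] False by (simp add: power2_eq_square)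
    ultimately show ?thesis
      by (simp add: pos_divide_le_eq power_mult_distrib)
  qed
  then show ?thesis
    unfolding b_def by (rule power2_le_imp_le) (simp add: A_seminorm_nonneg)
qed

end

text \<open>At the identity operator the semi-inner product is the inner product itself, so
  Cauchy-Schwarz and the parallelogram law for the norm become instances.\<close>

lemma positive_op_id: "positive_op (\<lambda>x::'a::complex_inner. x)"
  by (auto simp: positive_op_def bounded_clinear_id cinner_self simp flip: of_real_power)

lemma A_seminorm_id: "A_seminorm (\<lambda>x. x) x = norm (x::'a::complex_inner)"
  by (simp add: A_seminorm_def A_inner_def cinner_self flip: of_real_power)

lemma cinner_cauchy_schwarz: "cmod (cinner x y) \<le> norm x * norm (y::'a::complex_inner)"
  using A_cauchy_schwarz[OF positive_op_id, of x y] by (simp add: A_seminorm_id A_inner_def)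

lemma norm_parallelogram:
  "(norm (x + y))\<^sup>2 + (norm (x - y))\<^sup>2 = 2 * ((norm x)\<^sup>2 + (norm (y::'a::complex_inner))\<^sup>2)"
  using A_seminorm_parallelogram[OF positive_op_id, of x y] by (simp add: A_seminorm_id)

lemma norm_scaleC: "norm (c *\<^sub>C x) = cmod c * norm (x::'a::complex_inner)"
  using A_seminorm_scaleC[OF positive_op_id, of c x] by (simp add: A_seminorm_id)

lemma bounded_clinear_scaleC:
  assumes S: "bounded_clinear S"
  shows "bounded_clinear (\<lambda>x. c *\<^sub>C S x)"
proof -
  obtain K where K: "\<And>x. norm (S x) \<le> norm x * K" using bounded_clinear_bound[OF S] by metis
  show ?thesis
  proof (rule bounded_clinear_intro[where K="cmod c * K"])
    show "norm (c *\<^sub>C S x) \<le> norm x * (cmod c * K)" for x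
      using mult_left_mono[OF K, of "cmod c" x] by (simp add: norm_scaleC mult_ac)
  qed (simp_all add: bounded_clinearD[OF S] scaleC_add_right scaleC_scaleC mult.commute)
qed

lemma bounded_clinear_diff:
  assumes "bounded_clinear S" "bounded_clinear R"
  shows "bounded_clinear (\<lambda>x. S x - R x)"
proof -
  have "(-1) *\<^sub>C x = - x" for x :: 'a
    using scaleR_eq_scaleC[of "-1" x] by simp
  then show ?thesis
    using bounded_clinear_add[OF assms(1) bounded_clinear_scaleC[OF assms(2), of "-1"]] by simp
qed

section \<open>Projections, the Riesz theorem and adjoints\<close>

text \<open>A minimising sequence is Cauchy: the midpoint of two terms stays in \<open>M\<close>, so
  the parallelogram law controls their distance by their excess over the infimum.\<close>

lemma closest_point_of_midpoint_closed:
  fixes x :: "'a::chilbert_space"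
  assumes cl: "closed M" and ne: "M \<noteq> {}"
    and mid: "\<And>y z. y \<in> M \<Longrightarrow> z \<in> M \<Longrightarrow> (1/2) *\<^sub>R (y + z) \<in> M"
  obtains m where "m \<in> M" "\<And>y. y \<in> M \<Longrightarrow> norm (x - m) \<le> norm (x - y)"
proof -
  define D where "D = (\<lambda>y. (norm (x - y))\<^sup>2)"
  define d where "d = Inf (D ` M)"
  have bdd: "bdd_below (D ` M)"
    by (rule bdd_belowI[of _ 0]) (auto simp: D_def)
  have dle: "d \<le> D y" if "y \<in> M" for y
    unfolding d_def using that bdd by (simp add: cINF_lower)
  have "\<exists>y\<in>M. D y < d + 1 / real (Suc n)" for n
    using cInf_lessD[of "D ` M" "d + 1 / real (Suc n)"] ne by (auto simp: d_def)
  then obtain s where sM: "\<And>n. s n \<in> M" and sD: "\<And>n. D (s n) < d + 1 / real (Suc n)"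
    by metis
  have close: "(norm (s i - s j))\<^sup>2 \<le> 2 / real (Suc i) + 2 / real (Suc j)" for i j
  proof -
    have d: "d \<le> D ((1/2) *\<^sub>R (s i + s j))" "D (s i) < d + 1 / real (Suc i)"
      "D (s j) < d + 1 / real (Suc j)"
      by (intro dle mid sM sD)+
    have e: "(x - s j) + (x - s i) = 2 *\<^sub>R (x - (1/2) *\<^sub>R (s i + s j))"
      by (simp add: algebra_simps scaleR_2)
    have "(norm ((x - s j) + (x - s i)))\<^sup>2 = 4 * D ((1/2) *\<^sub>R (s i + s j))"
      unfolding e D_def by (simp add: power_mult_distrib)
    moreover have "(norm ((x - s j) + (x - s i)))\<^sup>2 + (norm (s i - s j))\<^sup>2
        = 2 * (D (s j) + D (s i))"
      using norm_parallelogram[of "x - s j" "x - s i"] by (simp add: D_def)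
    ultimately have "(norm (s i - s j))\<^sup>2 = 2 * (D (s j) + D (s i)) - 4 * D ((1/2) *\<^sub>R (s i + s j))"
      by linarith
    also have "\<dots> \<le> 2 * (1 / real (Suc i)) + 2 * (1 / real (Suc j))"
      using d by (simp del: of_nat_Suc)
    finally show ?thesis by simp
  qed
  have "Cauchy s"
  proof (rule metric_CauchyI)
    fix e :: real assume "e > 0"
    \<comment> \<open>The threshold 4 / e^2 makes each of the two terms in \<open>close\<close>
      smaller than e^2 / 2.\<close>
    then obtain N where N: "4 / e\<^sup>2 < real N" using reals_Archimedean2 by blast
    have "dist (s i) (s j) < e" if "i \<ge> N" "j \<ge> N" for i j
    proof -
      have t: "2 / real (Suc k) < e\<^sup>2 / 2" if "k \<ge> N" for k
      proof -
        have "4 / e\<^sup>2 < real (Suc k)" using N that by linarith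
        then show ?thesis using \<open>e > 0\<close> by (simp add: field_simps)
      qed
      have "(norm (s i - s j))\<^sup>2 < e\<^sup>2"
        using close[of i j] t[OF that(1)] t[OF that(2)] by linarith
      then show ?thesis
        using \<open>e > 0\<close> by (simp add: dist_norm power_less_imp_less_base)
    qed
    then show "\<exists>N. \<forall>i\<ge>N. \<forall>j\<ge>N. dist (s i) (s j) < e" by blast
  qed
  then obtain m where m: "s \<longlonglongrightarrow> m" using Cauchy_convergent_iff convergent_def by blast
  have "m \<in> M" using cl m sM closed_sequentially by blast
  have "(\<lambda>n. D (s n)) \<longlonglongrightarrow> D m" unfolding D_def by (intro tendsto_intros m)
  moreover have "(\<lambda>n. d + 1 / real (Suc n)) \<longlonglongrightarrow> d + 0"
    by (intro tendsto_intros LIMSEQ_Suc[OF lim_1_over_n])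
  ultimately have "D m \<le> d + 0"
    by (rule LIMSEQ_le) (use sD less_imp_le in blast)
  then have "norm (x - m) \<le> norm (x - y)" if "y \<in> M" for y
    using dle[OF that] unfolding D_def by (smt (verit) norm_ge_zero power2_le_imp_le)
  then show thesis using that \<open>m \<in> M\<close> by blast
qed

lemma orthogonal_decomposition:
  fixes x :: "'a::chilbert_space"
  assumes cl: "closed M" and zero: "0 \<in> M"
    and add: "\<And>y z. y \<in> M \<Longrightarrow> z \<in> M \<Longrightarrow> y + z \<in> M"
    and scale: "\<And>c y. y \<in> M \<Longrightarrow> c *\<^sub>C y \<in> M"
  obtains m where "m \<in> M" "x - m \<in> orth_compl M"
proof -
  have "(1/2) *\<^sub>R (y + z) \<in> M" if "y \<in> M" "z \<in> M" for y z
    using add scale that scaleR_eq_scaleC by metis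
  then obtain m where m: "m \<in> M" and min: "\<And>y. y \<in> M \<Longrightarrow> norm (x - m) \<le> norm (x - y)"
    using closest_point_of_midpoint_closed[OF cl, of x] zero by blast
  have "cinner (x - m) y = 0" if y: "y \<in> M" for y
  proof (cases "y = 0")
    case False
    \<comment> \<open>\<open>c *\<^sub>C y\<close> is the projection of \<open>v\<close> onto the
      line through \<open>y\<close>. Removing it lowers the squared norm by |b|^2 / ||y||^2, which
      minimality forbids unless b = 0.\<close>
    define v b c where "v = x - m" and "b = cinner v y" and "c = b / complex_of_real ((norm y)\<^sup>2)"
    have yv: "cinner y v = cnj b" using cinner_commute b_def by metis
    have "norm v \<le> norm (x - (m + c *\<^sub>C y))"
      unfolding v_def using min add m scale y by blast
    then have "(norm v)\<^sup>2 \<le> (norm (v - c *\<^sub>C y))\<^sup>2"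
      by (simp add: v_def diff_diff_eq power_mono)
    moreover have "complex_of_real ((norm (v - c *\<^sub>C y))\<^sup>2)
        = complex_of_real ((norm v)\<^sup>2 - (cmod b)\<^sup>2 / (norm y)\<^sup>2)"
    proof -
      have "complex_of_real ((norm (v - c *\<^sub>C y))\<^sup>2)
          = complex_of_real ((norm v)\<^sup>2) - cnj c * b - c * cnj b
            + c * cnj c * complex_of_real ((norm y)\<^sup>2)"
        unfolding cinner_self[symmetric]
        by (simp add: cinner_diff_left cinner_diff_right cinner_scaleC_left cinner_scaleC_right
            yv b_def[symmetric] algebra_simps)
      also have "\<dots> = complex_of_real ((norm v)\<^sup>2)
          - b * cnj b / complex_of_real ((norm y)\<^sup>2)"
        using False unfolding c_def by (simp add: field_simps)
      finally show ?thesis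
        by (simp only: complex_norm_square of_real_diff of_real_divide)
    qed
    ultimately have "(cmod b)\<^sup>2 / (norm y)\<^sup>2 \<le> 0"
      using of_real_eq_iff by (smt (verit, best))
    then show ?thesis
      using False by (simp add: b_def v_def divide_le_0_iff)
  qed simp
  then show thesis using that m by (simp add: orth_compl_def)
qed

text \<open>A vector \<open>v\<close> orthogonal to the kernel with \<open>f v\<close> nonzero
  represents \<open>f\<close> after scaling, because
  \<open>f v *\<^sub>C x - f x *\<^sub>C v\<close> lies in the kernel.\<close>

lemma riesz_representation:
  fixes f :: "'a::chilbert_space \<Rightarrow> complex"
  assumes bl: "bounded_linear f" and sc: "\<And>c x. f (c *\<^sub>C x) = c * f x"
  shows "\<exists>y. \<forall>x. f x = cinner x y"
proof (cases "\<forall>x. f x = 0")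
  case True
  then show ?thesis by (intro exI[of _ 0]) simp
next
  case False
  then obtain x0 where x0: "f x0 \<noteq> 0" by blast
  note lin = linear_simps[OF bl]
  have cl: "closed {z. f z = 0}"
    using closed_Collect_eq[of f "\<lambda>_. 0"] linear_continuous_on[OF bl] by simp
  obtain m where m: "f m = 0" and orth: "x0 - m \<in> orth_compl {z. f z = 0}"
    by (rule orthogonal_decomposition[OF cl, of x0]) (auto simp: lin sc)
  define v where "v = x0 - m"
  have fv: "f v \<noteq> 0" using x0 m by (simp add: v_def lin)
  then have v0: "v \<noteq> 0" using lin by auto
  have "f x = cinner x ((cnj (f v) / complex_of_real ((norm v)\<^sup>2)) *\<^sub>C v)" for x
  proof -
    define w where "w = f v *\<^sub>C x - f x *\<^sub>C v"
    have "f w = 0" by (simp add: w_def lin sc)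
    then have "cinner v w = 0" using orth by (simp add: orth_compl_def v_def)
    then have "cinner w v = 0" using cinner_commute[of w v] by simp
    then have "f v * cinner x v = f x * complex_of_real ((norm v)\<^sup>2)"
      by (simp add: w_def cinner_diff_left cinner_scaleC_left cinner_self)
    then show ?thesis
      using v0 by (simp add: cinner_scaleC_right field_simps)
  qed
  then show ?thesis by blast
qed

text \<open>\<open>cadjoint\<close> is a definite description: existence is the Riesz theorem
  applied for each \<open>y\<close>, uniqueness is nondegeneracy of the inner product.\<close>

lemma cinner_cadjoint:
  fixes S :: "'a::chilbert_space \<Rightarrow> 'a"
  assumes S: "bounded_clinear S"
  shows "cinner (S x) y = cinner x (cadjoint S y)"
proof -
  obtain K where K: "\<And>x. norm (S x) \<le> norm x * K" using bounded_clinear_bound[OF S] by metis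
  have "\<exists>z. \<forall>x. cinner (S x) y = cinner x z" for y
  proof (rule riesz_representation)
    show "bounded_linear (\<lambda>x. cinner (S x) y)"
    proof (rule bounded_linear_intro[where K="K * norm y"])
      fix x
      have "cmod (cinner (S x) y) \<le> norm (S x) * norm y" by (rule cinner_cauchy_schwarz)
      also have "\<dots> \<le> norm x * K * norm y" by (intro mult_right_mono K) simp
      finally show "cmod (cinner (S x) y) \<le> norm x * (K * norm y)" by (simp add: mult.assoc)
    qed (simp_all add: bounded_clinearD[OF S] cinner_add_left scaleR_eq_scaleC
        cinner_scaleC_left scaleR_conv_of_real scaleC_complex_def)
  qed (simp add: bounded_clinearD[OF S] cinner_scaleC_left)
  then obtain R where R: "\<And>x y. cinner (S x) y = cinner x (R y)" by metis
  have "\<forall>x y. cinner (S x) y = cinner x (cadjoint S y)"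
    unfolding cadjoint_def
  proof (rule theI[of _ R])
    fix R' assume "\<forall>x y. cinner (S x) y = cinner x (R' y)"
    then have "cinner x (R' y) = cinner x (R y)" for x y using R by metis
    then show "R' = R" using cinner_eqI by blast
  qed (use R in blast)
  then show ?thesis by blast
qed

section \<open>The distinguished adjoint\<close>

context
  fixes A :: "'a::chilbert_space \<Rightarrow> 'a"
  assumes pos: "positive_op A"
begin

text \<open>The difference lies in ker A and is orthogonal to it. This injectivity pins down the
  values of \<open>moore_penrose\<close> and later yields linearity of the adjoint.\<close>

lemma orth_kernel_eqI:
  assumes "x \<in> orth_compl {z. A z = 0}" "y \<in> orth_compl {z. A z = 0}" "A x = A y"
  shows "x = y"
proof -
  have "A (x - y) = 0"
    using assms(3) by (simp add: bounded_clinearD[OF positive_op_clinear[OF pos]])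
  then have "cinner (x - y) (x - y) = 0"
    using assms(1,2) by (simp add: orth_compl_def cinner_diff_left)
  then show ?thesis using cinner_eq_zero_imp by fastforce
qed

text \<open>The inverse sends \<open>A w\<close> to the projection of \<open>w\<close> onto the
  complement of ker A. The estimate is against \<open>w\<close> rather than \<open>A w\<close>, so
  it holds even when \<open>range A\<close> is not closed.\<close>

lemma moore_penrose_range:
  shows "A (moore_penrose A (A w)) = A w"
    and "moore_penrose A (A w) \<in> orth_compl {z. A z = 0}"
    and "norm (moore_penrose A (A w)) \<le> norm w"
proof -
  note lin = bounded_clinearD[OF positive_op_clinear[OF pos]]
  have bl: "bounded_linear A"
    using positive_op_clinear[OF pos] by (simp add: bounded_clinear_def)
  have cl: "closed {z. A z = 0}"
    using closed_Collect_eq[of A "\<lambda>_. 0"] linear_continuous_on[OF bl] by simp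
  obtain m where m: "A m = 0" and orth: "w - m \<in> orth_compl {z. A z = 0}"
    by (rule orthogonal_decomposition[OF cl, of w])
      (auto simp: lin scaleC_zero_right)
  have Aw: "A (w - m) = A w" using m by (simp add: lin)
  have mp: "moore_penrose A (A w) = w - m"
    unfolding moore_penrose_def
  proof (rule the_equality)
    show "w - m \<in> orth_compl {z. A z = 0} \<and> A w - A (w - m) \<in> orth_compl (range A)"
      using orth Aw by (simp add: orth_compl_def)
  next
    fix x assume x: "x \<in> orth_compl {z. A z = 0} \<and> A w - A x \<in> orth_compl (range A)"
    \<comment> \<open>The residual lies both in \<open>range A\<close> and in its orthogonal
      complement.\<close>
    then have "cinner (A w - A x) (A (w - x)) = 0" by (simp add: orth_compl_def)
    then have "A w = A x" using cinner_eq_zero_imp by (fastforce simp: lin)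
    then show "x = w - m" using x orth Aw orth_kernel_eqI by metis
  qed
  show "A (moore_penrose A (A w)) = A w" using Aw mp by simp
  show "moore_penrose A (A w) \<in> orth_compl {z. A z = 0}" using orth mp by simp
  have "cinner (w - m) m = 0" using orth m by (simp add: orth_compl_def)
  then have "cinner (w - m) (w - m) = cinner (w - m) w" by (simp add: cinner_diff_right)
  then have "(norm (w - m))\<^sup>2 = cmod (cinner (w - m) w)"
    by (metis abs_of_nonneg cinner_self norm_of_real zero_le_power2)
  then have "norm (w - m) * norm (w - m) \<le> norm (w - m) * norm w"
    using cinner_cauchy_schwarz[of "w - m" w] by (simp add: power2_eq_square)
  then show "norm (moore_penrose A (A w)) \<le> norm w"
    unfolding mp by (cases "w - m = 0") auto
qed

lemma A_inner_adjoint: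
  assumes S: "bounded_clinear S" and R: "A \<circ> R = cadjoint S \<circ> A"
  shows "A_inner A (S x) y = A_inner A x (R y)"
proof -
  have sym: "cinner (A u) v = cinner u (A v)" for u v
    using A_inner_commute[OF pos, of u v] cinner_commute by (metis A_inner_def)
  have "A_inner A (S x) y = cinner x (cadjoint S (A y))"
    by (simp add: A_inner_def sym cinner_cadjoint[OF S])
  also have "\<dots> = cinner x (A (R y))" using R by (metis comp_apply)
  finally show ?thesis by (simp add: A_inner_def sym)
qed

text \<open>\<open>A_adjoint A S\<close> is \<open>R\<close> followed by the projection onto the
  complement of ker A, so it inherits the bound of \<open>R\<close> and differs from it only inside
  ker A. With the form identity as hypothesis, the lemma applies again to
  \<open>A_adjoint A S\<close> itself.\<close>

lemma A_adjoint_eqI: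
  assumes S: "bounded_clinear S" and R: "bounded_clinear R"
    and SR: "\<And>x y. A_inner A (S x) y = A_inner A x (R y)"
  shows "bounded_clinear (A_adjoint A S)" and "A (A_adjoint A S z) = A (R z)"
proof -
  note lin = bounded_clinearD[OF positive_op_clinear[OF pos]] bounded_clinearD[OF R]
  have sym: "cinner (A u) v = cinner u (A v)" for u v
    using A_inner_commute[OF pos, of u v] cinner_commute by (metis A_inner_def)
  have "cadjoint S (A y) = A (R y)" for y
  proof (rule cinner_eqI)
    fix x
    have "cinner x (cadjoint S (A y)) = A_inner A (S x) y"
      by (simp add: A_inner_def sym cinner_cadjoint[OF S])
    then show "cinner x (cadjoint S (A y)) = cinner x (A (R y))"
      by (simp add: SR) (simp add: A_inner_def sym)
  qed
  then have eq: "A_adjoint A S z = moore_penrose A (A (R z))" for z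
    by (simp add: A_adjoint_def)
  have AS: "A (A_adjoint A S z) = A (R z)" for z
    by (simp add: eq moore_penrose_range)
  then show "A (A_adjoint A S z) = A (R z)" .
  obtain K where K: "\<And>x. norm (R x) \<le> norm x * K" using bounded_clinear_bound[OF R] by metis
  have mem: "A_adjoint A S z \<in> orth_compl {z. A z = 0}" for z
    by (simp add: eq moore_penrose_range)
  show "bounded_clinear (A_adjoint A S)"
  proof (rule bounded_clinear_intro)
    fix x y
    have "A_adjoint A S x + A_adjoint A S y \<in> orth_compl {z. A z = 0}"
      using mem[of x] mem[of y] by (simp add: orth_compl_def cinner_add_left)
    then show "A_adjoint A S (x + y) = A_adjoint A S x + A_adjoint A S y"
      by (rule orth_kernel_eqI[OF mem]) (simp add: AS lin)
  next
    fix c x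
    have "c *\<^sub>C A_adjoint A S x \<in> orth_compl {z. A z = 0}"
      using mem[of x] by (simp add: orth_compl_def cinner_scaleC_left)
    then show "A_adjoint A S (c *\<^sub>C x) = c *\<^sub>C A_adjoint A S x"
      by (rule orth_kernel_eqI[OF mem]) (simp add: AS lin)
  next
    fix x
    show "norm (A_adjoint A S x) \<le> norm x * K"
      unfolding eq using moore_penrose_range(3) K order_trans by blast
  qed
qed

end

section \<open>Seminorm bounds\<close>

context
  fixes A :: "'a::complex_inner \<Rightarrow> 'a"
  assumes pos: "positive_op A"
begin

lemma A_seminorm_le_norm:
  obtains K where "K > 0" "\<And>x. A_seminorm A x \<le> K * norm x"
proof -
  obtain K where K: "K > 0" "\<And>x. norm (A x) \<le> norm x * K"
    using bounded_clinear_bound[OF positive_op_clinear[OF pos]] by metis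
  have "A_seminorm A x \<le> sqrt K * norm x" for x
  proof (rule power2_le_imp_le)
    have "(A_seminorm A x)\<^sup>2 \<le> cmod (cinner (A x) x)"
      by (simp add: A_seminorm_sq[OF pos] A_inner_def complex_Re_le_cmod)
    also have "\<dots> \<le> norm (A x) * norm x" by (rule cinner_cauchy_schwarz)
    also have "\<dots> \<le> norm x * K * norm x" by (intro mult_right_mono K) simp
    also have "\<dots> = (sqrt K * norm x)\<^sup>2"
      using K(1) unfolding power_mult_distrib by (simp add: power2_eq_square[of "norm x"])
    finally show "(A_seminorm A x)\<^sup>2 \<le> (sqrt K * norm x)\<^sup>2" .
  qed (use K(1) in simp)
  then show thesis using that K(1) by (metis real_sqrt_gt_zero)
qed

text \<open>Reid's argument: \<open>\<parallel>H z\<parallel>\<^sup>2 = \<langle>H\<^sup>2 z, z\<rangle> \<le> \<parallel>H\<^sup>2 z\<parallel> \<parallel>z\<parallel>\<close>, iterated over the powers \<open>H ^ (2 ^ n)\<close>,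
  bounds the seminorm of \<open>H\<close> by its operator norm.\<close>

lemma A_seminorm_selfadjoint_bounded:
  assumes H: "bounded_clinear H"
    and sa: "\<And>x y. A_inner A (H x) y = A_inner A x (H y)"
  obtains K where "K \<ge> 0" "\<And>x. A_seminorm A (H x) \<le> K * A_seminorm A x"
proof -
  obtain K where K: "K > 0" "\<And>x. norm (H x) \<le> norm x * K"
    using bounded_clinear_bound[OF H] by metis
  obtain L where L: "L > 0" "\<And>x. A_seminorm A x \<le> L * norm x"
    using A_seminorm_le_norm by metis
  have iter_norm: "norm ((H ^^ k) x) \<le> K ^ k * norm x" for k x
  proof (induction k)
    case (Suc k)
    have "norm ((H ^^ Suc k) x) \<le> norm ((H ^^ k) x) * K" using K(2) by simp
    also have "\<dots> \<le> K ^ k * norm x * K" using Suc K(1) by (intro mult_right_mono) auto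
    finally show ?case by (simp add: mult_ac)
  qed simp
  have iter_sa: "A_inner A ((H ^^ k) x) y = A_inner A x ((H ^^ k) y)" for k x y
    by (induction k arbitrary: x y) (simp_all add: sa funpow_swap1)
  have step: "(A_seminorm A ((H ^^ k) x))\<^sup>2 \<le> A_seminorm A ((H ^^ (2 * k)) x) * A_seminorm A x" for k x
  proof -
    have "(A_seminorm A ((H ^^ k) x))\<^sup>2 = Re (A_inner A ((H ^^ k) x) ((H ^^ k) x))"
      by (rule A_seminorm_sq[OF pos])
    also have "\<dots> = Re (A_inner A ((H ^^ (2 * k)) x) x)"
      by (simp add: iter_sa[symmetric] mult_2 funpow_add)
    also have "\<dots> \<le> cmod (A_inner A ((H ^^ (2 * k)) x) x)" by (rule complex_Re_le_cmod)
    also have "\<dots> \<le> A_seminorm A ((H ^^ (2 * k)) x) * A_seminorm A x"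
      by (rule A_cauchy_schwarz[OF pos])
    finally show ?thesis .
  qed
  have unit: "A_seminorm A (H x) \<le> K" if x: "A_seminorm A x = 1" for x
  proof (rule ccontr)
    assume "\<not> A_seminorm A (H x) \<le> K"
    then have r: "A_seminorm A (H x) / K > 1" using K(1) by simp
    have pow: "(A_seminorm A (H x)) ^ (2 ^ n) \<le> A_seminorm A ((H ^^ (2 ^ n)) x)" for n
    proof (induction n)
      case (Suc n)
      have "(A_seminorm A (H x)) ^ (2 ^ Suc n) = ((A_seminorm A (H x)) ^ (2 ^ n))\<^sup>2"
        by (simp add: power_mult[symmetric] mult.commute)
      also have "\<dots> \<le> (A_seminorm A ((H ^^ (2 ^ n)) x))\<^sup>2"
        by (intro power_mono Suc) (simp add: A_seminorm_nonneg[OF pos])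
      also have "\<dots> \<le> A_seminorm A ((H ^^ (2 ^ Suc n)) x)"
        using step[of "2 ^ n" x] x by simp
      finally show ?case .
    qed simp
    \<comment> \<open>Powers of a ratio above 1 are unbounded, while
      \<open>A_seminorm A ((H ^^ k) x)\<close> is at most \<open>L * K ^ k * norm x\<close>. Passing
      from n to 2^n only increases the power.\<close>
    obtain n where n: "L * norm x < (A_seminorm A (H x) / K) ^ n"
      using real_arch_pow[OF r] by blast
    also have "\<dots> \<le> (A_seminorm A (H x) / K) ^ (2 ^ n)"
      using r by (intro power_increasing) (auto simp: less_imp_le less_exp)
    also have "\<dots> \<le> A_seminorm A ((H ^^ (2 ^ n)) x) / K ^ (2 ^ n)"
      unfolding power_divide using K(1) by (intro divide_right_mono pow) simp
    also have "\<dots> \<le> L * (K ^ (2 ^ n) * norm x) / K ^ (2 ^ n)"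
      using L K(1) iter_norm[of "2 ^ n" x]
      by (intro divide_right_mono order_trans[OF L(2)] mult_left_mono) auto
    finally show False using K(1) by simp
  qed
  show thesis
  proof (rule that)
    show "K \<ge> 0" using K(1) by simp
    fix x
    show "A_seminorm A (H x) \<le> K * A_seminorm A x"
    proof (cases "A_seminorm A x = 0")
      case True
      \<comment> \<open>An A-null vector cannot be normalised; \<open>step\<close> at exponent 1
        shows that \<open>H\<close> keeps it A-null.\<close>
      then have "(A_seminorm A (H x))\<^sup>2 \<le> 0" using step[of 1 x] by simp
      then show ?thesis using True by simp
    next
      case False
      define c where "c = complex_of_real (1 / A_seminorm A x)"
      have c: "cmod c = 1 / A_seminorm A x"
        by (simp add: c_def norm_divide A_seminorm_nonneg[OF pos])
      have "A_seminorm A (H (c *\<^sub>C x)) \<le> K"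
        using False by (intro unit) (simp add: A_seminorm_scaleC[OF pos] c)
      then show ?thesis
        using False A_seminorm_nonneg[OF pos, of x]
        by (simp add: bounded_clinearD[OF H] A_seminorm_scaleC[OF pos] c field_simps)
    qed
  qed
qed

text \<open>Since ||R x||_A^2 = <S R x, x>_A, one factor ||R x||_A cancels and the same constant
  serves.\<close>

lemma A_seminorm_adjoint_le:
  assumes SR: "\<And>x y. A_inner A (S x) y = A_inner A x (R y)"
    and K: "\<And>x. A_seminorm A (S x) \<le> K * A_seminorm A x"
  shows "A_seminorm A (R x) \<le> K * A_seminorm A x"
proof -
  have "(A_seminorm A (R x))\<^sup>2 = Re (A_inner A (S (R x)) x)"
    by (simp add: A_seminorm_sq[OF pos] SR)
  also have "\<dots> \<le> A_seminorm A (S (R x)) * A_seminorm A x"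
    using A_cauchy_schwarz[OF pos] complex_Re_le_cmod order_trans by blast
  also have "\<dots> \<le> K * A_seminorm A (R x) * A_seminorm A x"
    by (intro mult_right_mono K A_seminorm_nonneg[OF pos])
  finally have *: "A_seminorm A (R x) * A_seminorm A (R x)
      \<le> A_seminorm A (R x) * (K * A_seminorm A x)"
    by (simp add: power2_eq_square mult_ac)
  show ?thesis
  proof (cases "A_seminorm A (R x) = 0")
    case True
    then show ?thesis using K[of x] A_seminorm_nonneg[OF pos, of "S x"] by linarith
  next
    case False
    then show ?thesis
      using * A_seminorm_nonneg[OF pos, of "R x"] by simp
  qed
qed

text \<open>The composition of \<open>R\<close> after \<open>S\<close> is A-self-adjoint, so the
  self-adjoint case bounds it; ||S x||_A^2 = <R S x, x>_A transfers this bound at the cost of a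
  square root.\<close>

lemma A_seminorm_adjointable_bounded:
  assumes S: "bounded_clinear S" and R: "bounded_clinear R"
    and SR: "\<And>x y. A_inner A (S x) y = A_inner A x (R y)"
  obtains K where "K \<ge> 0" "\<And>x. A_seminorm A (S x) \<le> K * A_seminorm A x"
proof -
  have RS: "A_inner A (R x) y = A_inner A x (S y)" for x y
    using SR A_inner_commute[OF pos] by metis
  obtain K where K: "K \<ge> 0" "\<And>x. A_seminorm A (R (S x)) \<le> K * A_seminorm A x"
    using A_seminorm_selfadjoint_bounded[OF bounded_clinear_compose[OF R S]] RS SR by metis
  have "A_seminorm A (S x) \<le> sqrt K * A_seminorm A x" for x
  proof (rule power2_le_imp_le)
    have "(A_seminorm A (S x))\<^sup>2 = Re (A_inner A (R (S x)) x)"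
      by (simp add: A_seminorm_sq[OF pos] RS)
    also have "\<dots> \<le> A_seminorm A (R (S x)) * A_seminorm A x"
      using A_cauchy_schwarz[OF pos] complex_Re_le_cmod order_trans by blast
    also have "\<dots> \<le> K * A_seminorm A x * A_seminorm A x"
      by (intro mult_right_mono K A_seminorm_nonneg[OF pos])
    also have "\<dots> = (sqrt K * A_seminorm A x)\<^sup>2"
      using K(1) unfolding power_mult_distrib by (simp add: power2_eq_square[of "A_seminorm A x"])
    finally show "(A_seminorm A (S x))\<^sup>2 \<le> (sqrt K * A_seminorm A x)\<^sup>2" .
  qed (use K(1) A_seminorm_nonneg[OF pos] in simp)
  then show thesis using that K(1) by (metis real_sqrt_ge_zero)
qed

text \<open>The constant \<open>K\<close> serves twice: it makes the supremum finite, and it settles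
  the A-null vectors, which no rescaling brings to the unit sphere.\<close>

lemma A_opnorm_upper:
  assumes S: "bounded_clinear S" and K: "\<And>x. A_seminorm A (S x) \<le> K * A_seminorm A x"
  shows "A_seminorm A (S x) \<le> A_opnorm A S * A_seminorm A x"
proof (cases "A_seminorm A x = 0")
  case True
  then show ?thesis using K[of x] by simp
next
  case False
  define c where "c = complex_of_real (1 / A_seminorm A x)"
  have c: "cmod c = 1 / A_seminorm A x"
    by (simp add: c_def norm_divide A_seminorm_nonneg[OF pos])
  have mem: "c *\<^sub>C x \<in> A_unit A"
    using False by (simp add: A_unit_def A_seminorm_scaleC[OF pos] c)
  have "bdd_above ((\<lambda>z. A_seminorm A (S z)) ` A_unit A)"
    using K by (intro bdd_aboveI2[of _ _ K]) (metis (mono_tags) A_unit_def mem_Collect_eq mult.right_neutral)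
  then have "A_seminorm A (S (c *\<^sub>C x)) \<le> A_opnorm A S"
    using mem by (auto simp: A_opnorm_def intro: cSUP_upper)
  then show ?thesis
    using False A_seminorm_nonneg[OF pos, of x]
    by (simp add: bounded_clinearD[OF S] A_seminorm_scaleC[OF pos] c field_simps)
qed

lemma A_opnorm_nonneg:
  assumes "bounded_clinear S" and "\<And>x. A_seminorm A (S x) \<le> K * A_seminorm A x"
  shows "A_opnorm A S \<ge> 0"
proof (cases "A_unit A = {}")
  case False
  then obtain z where "A_seminorm A z = 1" by (auto simp: A_unit_def)
  then show ?thesis
    using A_opnorm_upper[of S K z, OF assms] A_seminorm_nonneg[OF pos, of "S z"] by simp
qed (simp add: A_opnorm_def)

lemma A_numradius_upper:
  assumes K: "\<And>x. A_seminorm A (S x) \<le> K * A_seminorm A x" and z: "z \<in> A_unit A"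
  shows "cmod (A_inner A (S z) z) \<le> A_numradius A S"
proof -
  have "cmod (A_inner A (S x) x) \<le> K" if "x \<in> A_unit A" for x
    using A_cauchy_schwarz[OF pos, of "S x" x] K[of x] that by (simp add: A_unit_def)
  then have "bdd_above ((\<lambda>z. cmod (A_inner A (S z) z)) ` A_unit A)"
    by (intro bdd_aboveI2)
  then show ?thesis
    using z by (auto simp: A_numradius_def intro: cSUP_upper)
qed

lemma A_crawford_lower:
  assumes z: "z \<in> A_unit A"
  shows "A_crawford A S \<le> cmod (A_inner A (S z) z)" "A_crawford A S \<ge> 0"
proof -
  have "bdd_below ((\<lambda>z. cmod (A_inner A (S z) z)) ` A_unit A)"
    by (rule bdd_belowI2[of _ 0]) simp
  then show "A_crawford A S \<le> cmod (A_inner A (S z) z)"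
    using z by (auto simp: A_crawford_def intro: cINF_lower)
  show "A_crawford A S \<ge> 0"
    using z by (auto simp: A_crawford_def intro: cINF_greatest)
qed

text \<open>Polarisation: for self-adjoint \<open>B\<close>, four times the real part of <B x, y>_A
  is the difference of the quadratic form at x + y and x - y, which homogeneity and the
  parallelogram law bound.\<close>

lemma A_selfadjoint_seminorm_le:
  assumes B: "bounded_clinear B"
    and sa: "\<And>x y. A_inner A (B x) y = A_inner A x (B y)"
    and w: "\<And>z. z \<in> A_unit A \<Longrightarrow> cmod (A_inner A (B z) z) \<le> w"
    and z: "z \<in> A_unit A"
  shows "A_seminorm A (B z) \<le> w"
proof -
  note lin = bounded_clinearD[OF B]
  have quad: "cmod (A_inner A (B x) x) \<le> w * (A_seminorm A x)\<^sup>2" for x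
  proof (cases "A_seminorm A x = 0")
    case True
    then show ?thesis using A_cauchy_schwarz[OF pos, of "B x" x] by simp
  next
    case False
    define c where "c = complex_of_real (1 / A_seminorm A x)"
    have c: "cmod c = 1 / A_seminorm A x"
      by (simp add: c_def norm_divide A_seminorm_nonneg[OF pos])
    have "c *\<^sub>C x \<in> A_unit A"
      using False by (simp add: A_unit_def A_seminorm_scaleC[OF pos] c)
    from w[OF this] have "cmod (A_inner A (B x) x) / (A_seminorm A x)\<^sup>2 \<le> w"
      by (simp add: lin A_inner_simps[OF pos] norm_mult c power2_eq_square)
    then show ?thesis
      using False by (simp add: pos_divide_le_eq)
  qed
  have polar: "4 * Re (A_inner A (B x) y) \<le> 2 * w * ((A_seminorm A x)\<^sup>2 + (A_seminorm A y)\<^sup>2)" for x y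
  proof -
    have yx: "A_inner A (B y) x = cnj (A_inner A (B x) y)"
      using sa A_inner_commute[OF pos] by metis
    have "4 * Re (A_inner A (B x) y)
        = Re (A_inner A (B (x + y)) (x + y)) - Re (A_inner A (B (x - y)) (x - y))"
      by (simp add: lin A_inner_simps[OF pos] yx)
    also have "\<dots> \<le> cmod (A_inner A (B (x + y)) (x + y)) + cmod (A_inner A (B (x - y)) (x - y))"
      using complex_Re_le_cmod[of "A_inner A (B (x + y)) (x + y)"]
        abs_Re_le_cmod[of "A_inner A (B (x - y)) (x - y)"] by linarith
    also have "\<dots> \<le> w * (A_seminorm A (x + y))\<^sup>2 + w * (A_seminorm A (x - y))\<^sup>2"
      by (intro add_mono quad)
    also have "\<dots> = 2 * w * ((A_seminorm A x)\<^sup>2 + (A_seminorm A y)\<^sup>2)"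
      unfolding distrib_left[symmetric] A_seminorm_parallelogram[OF pos] by simp
    finally show ?thesis .
  qed
  have z1: "A_seminorm A z = 1" using z by (simp add: A_unit_def)
  show ?thesis
  proof (cases "A_seminorm A (B z) = 0")
    case True
    then show ?thesis using w[OF z] norm_ge_zero order_trans by metis
  next
    case False
    define r where "r = A_seminorm A (B z)"
    have r: "r > 0" using False A_seminorm_nonneg[OF pos, of "B z"] by (simp add: r_def)
    \<comment> \<open>\<open>y\<close> is the A-unit vector with <B z, y>_A = ||B z||_A, so
      \<open>polar\<close> reads 4 r \<le> 4 w.\<close>
    define y where "y = complex_of_real (1 / r) *\<^sub>C B z"
    have "A_seminorm A y = 1"
      using r by (simp add: y_def A_seminorm_scaleC[OF pos] norm_divide flip: r_def)
    moreover have "Re (A_inner A (B z) y) = r"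
      using r by (simp add: y_def A_inner_simps[OF pos] A_inner_self[OF pos] power2_eq_square
          flip: r_def)
    ultimately show ?thesis using polar[of z y] z1 by (simp add: r_def)
  qed
qed

text \<open>A self-adjoint operator has seminorm equal to its numerical radius, so a pointwise bound on
  the two quadratic forms becomes a bound on the seminorm of one of the operators.\<close>

lemma A_opnorm_crawford_le:
  assumes ne: "A_unit A \<noteq> {}" and B: "bounded_clinear B"
    and sa: "\<And>x y. A_inner A (B x) y = A_inner A x (B y)"
    and sum: "\<And>z. z \<in> A_unit A \<Longrightarrow>
      (cmod (A_inner A (B z) z))\<^sup>2 + (cmod (A_inner A (C z) z))\<^sup>2 \<le> w"
  shows "(A_opnorm A B)\<^sup>2 + (A_crawford A C)\<^sup>2 \<le> w"
proof -
  have B2: "(cmod (A_inner A (B z) z))\<^sup>2 \<le> w - (A_crawford A C)\<^sup>2" if "z \<in> A_unit A" for z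
    using sum[OF that] power_mono[OF A_crawford_lower[OF that], of C 2] by linarith
  have "A_seminorm A (B z) \<le> sqrt (w - (A_crawford A C)\<^sup>2)" if "z \<in> A_unit A" for z
    using A_selfadjoint_seminorm_le[OF B sa _ that] B2 real_le_rsqrt by blast
  then have "A_opnorm A B \<le> sqrt (w - (A_crawford A C)\<^sup>2)"
    using ne by (auto simp: A_opnorm_def intro: cSUP_least)
  moreover obtain K where "\<And>x. A_seminorm A (B x) \<le> K * A_seminorm A x"
    using A_seminorm_selfadjoint_bounded[OF B sa] by metis
  then have "A_opnorm A B \<ge> 0" by (rule A_opnorm_nonneg[OF B])
  moreover obtain z where "z \<in> A_unit A" using ne by blast
  \<comment> \<open>A nonnegative radicand is what allows the bound on \<open>A_opnorm A B\<close>
    to be squared back.\<close>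
  then have "0 \<le> w - (A_crawford A C)\<^sup>2" using B2 order_trans zero_le_power2 by blast
  ultimately show ?thesis
    using power_mono[of "A_opnorm A B" "sqrt (w - (A_crawford A C)\<^sup>2)" 2] by simp
qed

end

section \<open>Operators with an A-adjoint: Cartesian parts and mixed products\<close>

context
  fixes A :: "'a::chilbert_space \<Rightarrow> 'a"
  assumes pos: "positive_op A"
begin

lemma A_adjointableE:
  assumes "S \<in> A_adjointable A"
  obtains R where "bounded_clinear S" "bounded_clinear R"
    "\<And>x y. A_inner A (S x) y = A_inner A x (R y)"
  using assms A_inner_adjoint[OF pos] unfolding A_adjointable_def by blast

lemma A_adjointable_opnorm:
  assumes S: "S \<in> A_adjointable A"
  shows "A_seminorm A (S x) \<le> A_opnorm A S * A_seminorm A x" and "A_opnorm A S \<ge> 0"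
proof -
  obtain R where R: "bounded_clinear S" "bounded_clinear R"
    "\<And>x y. A_inner A (S x) y = A_inner A x (R y)"
    using A_adjointableE[OF S] by metis
  obtain K where "\<And>x. A_seminorm A (S x) \<le> K * A_seminorm A x"
    using A_seminorm_adjointable_bounded[OF pos R] by metis
  then show "A_seminorm A (S x) \<le> A_opnorm A S * A_seminorm A x" "A_opnorm A S \<ge> 0"
    using A_opnorm_upper[OF pos R(1)] A_opnorm_nonneg[OF pos R(1)] by blast+
qed

text \<open>With \<open>t = \<langle>T z, z\<rangle>\<close> the forms of \<open>P\<close> and \<open>Q\<close> are \<open>Re t\<close> and \<open>- Im t\<close>, so those of \<open>P + Q\<close>
  and \<open>P - Q\<close> have squares adding up to \<open>2 \<bar>t\<bar>\<^sup>2\<close>. The absolute value in the bound comes from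
  \<open>a + b + \<bar>a - b\<bar> = 2 max a b\<close>.\<close>

lemma A_seminorm_cartesian_bound:
  fixes S T P Q :: "'a \<Rightarrow> 'a"
  assumes S_def: "S = A_adjoint A T"
    and P_def: "P = (\<lambda>z. (1 / 2) *\<^sub>C (S z + A_adjoint A S z))"
    and Q_def: "Q = (\<lambda>z. (1 / (2 * \<i>)) *\<^sub>C (S z - A_adjoint A S z))"
    and T: "T \<in> A_adjointable A" and z: "z \<in> A_unit A"
  shows "(A_seminorm A (T z))\<^sup>2 + (A_seminorm A (S z))\<^sup>2 \<le> 4 * ((A_numradius A T)\<^sup>2 - 1 / 4 *
      ((A_crawford A (\<lambda>z. P z - Q z))\<^sup>2 + (A_crawford A (\<lambda>z. P z + Q z))\<^sup>2
       + \<bar>(A_opnorm A (\<lambda>z. P z + Q z))\<^sup>2 - (A_opnorm A (\<lambda>z. P z - Q z))\<^sup>2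
          + (A_crawford A (\<lambda>z. P z - Q z))\<^sup>2 - (A_crawford A (\<lambda>z. P z + Q z))\<^sup>2\<bar>))"
    and "A_inner A (T x) y = A_inner A x (S y)"
proof -
  define S' where "S' = A_adjoint A S"
  obtain R where bT: "bounded_clinear T" and bR: "bounded_clinear R"
    and TR: "\<And>x y. A_inner A (T x) y = A_inner A x (R y)"
    using A_adjointableE[OF T] by metis
  have bS: "bounded_clinear S" and AS: "\<And>z. A (S z) = A (R z)"
    unfolding S_def using A_adjoint_eqI[OF pos bT bR TR] by auto
  have xS: "A_inner A x (S y) = A_inner A (T x) y" for x y
    using AS[of y] TR[of x y] A_inner_commute[OF pos] by (metis A_inner_def)
  then show "A_inner A (T x) y = A_inner A x (S y)" by simp
  have Sx: "A_inner A (S x) y = A_inner A x (T y)" for x y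
    using xS A_inner_commute[OF pos] by metis
  \<comment> \<open>\<open>T\<close> is an A-adjoint of \<open>S\<close>, so \<open>S'\<close>
    agrees with \<open>T\<close> modulo ker A, and the form allows replacing one by the other in
    either argument.\<close>
  have bS': "bounded_clinear S'" and AS': "\<And>z. A (S' z) = A (T z)"
    unfolding S'_def using A_adjoint_eqI[OF pos bS bT Sx] by auto
  have S'x: "A_inner A (S' x) y = A_inner A (T x) y" for x y
    by (simp add: A_inner_def AS')
  have xS': "A_inner A x (S' y) = A_inner A x (T y)" for x y
    using S'x A_inner_commute[OF pos] by metis
  note forms = A_inner_simps[OF pos] Sx xS S'x xS'
  have PQ: "P = (\<lambda>z. (1 / 2) *\<^sub>C (S z + S' z))" "Q = (\<lambda>z. (1 / (2 * \<i>)) *\<^sub>C (S z - S' z))"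
    by (simp_all add: P_def Q_def S'_def)
  have bP: "bounded_clinear P" and bQ: "bounded_clinear Q"
    unfolding PQ by (intro bounded_clinear_scaleC bounded_clinear_add bounded_clinear_diff bS bS')+
  have saP: "A_inner A (P x) y = A_inner A x (P y)" for x y
    by (simp add: PQ forms)
  have saQ: "A_inner A (Q x) y = A_inner A x (Q y)" for x y
    by (simp add: PQ forms field_simps)
  have formP: "A_inner A (P x) x = complex_of_real (Re (A_inner A (T x) x))"
    and formQ: "A_inner A (Q x) x = complex_of_real (- Im (A_inner A (T x) x))" for x
    using A_inner_commute[OF pos, of x "T x"]
    by (simp_all add: PQ forms complex_eq_iff)
  obtain K where "\<And>x. A_seminorm A (T x) \<le> K * A_seminorm A x"
    using A_adjointable_opnorm[OF T] by blast
  note num = A_numradius_upper[OF pos this]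
  have sum: "(cmod (A_inner A (P x + Q x) x))\<^sup>2 + (cmod (A_inner A (P x - Q x) x))\<^sup>2
      \<le> 2 * (A_numradius A T)\<^sup>2" if x: "x \<in> A_unit A" for x
  proof -
    have "(cmod (A_inner A (P x + Q x) x))\<^sup>2 + (cmod (A_inner A (P x - Q x) x))\<^sup>2
        = (Re (A_inner A (T x) x) - Im (A_inner A (T x) x))\<^sup>2
          + (Re (A_inner A (T x) x) + Im (A_inner A (T x) x))\<^sup>2"
      unfolding A_inner_simps[OF pos] formP formQ of_real_add[symmetric] of_real_diff[symmetric]
        norm_of_real by simp
    also have "\<dots> = 2 * (cmod (A_inner A (T x) x))\<^sup>2"
      unfolding cmod_power2 by (simp add: power2_eq_square algebra_simps)
    also have "\<dots> \<le> 2 * (A_numradius A T)\<^sup>2"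
      using num[OF x] by (intro mult_left_mono power_mono) auto
    finally show ?thesis .
  qed
  have ne: "A_unit A \<noteq> {}" using z by blast
  note bplus = bounded_clinear_add[OF bP bQ] and bminus = bounded_clinear_diff[OF bP bQ]
  have saplus: "A_inner A (P x + Q x) y = A_inner A x (P y + Q y)"
    and saminus: "A_inner A (P x - Q x) y = A_inner A x (P y - Q y)" for x y
    by (simp_all add: A_inner_simps[OF pos] saP saQ)
  have plus: "(A_opnorm A (\<lambda>z. P z + Q z))\<^sup>2 + (A_crawford A (\<lambda>z. P z - Q z))\<^sup>2
      \<le> 2 * (A_numradius A T)\<^sup>2"
    by (rule A_opnorm_crawford_le[OF pos ne bplus saplus sum])
  have minus: "(A_opnorm A (\<lambda>z. P z - Q z))\<^sup>2 + (A_crawford A (\<lambda>z. P z + Q z))\<^sup>2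
      \<le> 2 * (A_numradius A T)\<^sup>2"
    using sum by (intro A_opnorm_crawford_le[OF pos ne bminus saminus]) (simp add: add.commute)
  obtain K1 where K1: "\<And>x. A_seminorm A (P x + Q x) \<le> K1 * A_seminorm A x"
    using A_seminorm_selfadjoint_bounded[OF pos bplus saplus] by metis
  obtain K2 where K2: "\<And>x. A_seminorm A (P x - Q x) \<le> K2 * A_seminorm A x"
    using A_seminorm_selfadjoint_bounded[OF pos bminus saminus] by metis
  have z1: "A_seminorm A z = 1" using z by (simp add: A_unit_def)
  have le: "(A_seminorm A (P z + Q z))\<^sup>2 \<le> (A_opnorm A (\<lambda>z. P z + Q z))\<^sup>2"
    "(A_seminorm A (P z - Q z))\<^sup>2 \<le> (A_opnorm A (\<lambda>z. P z - Q z))\<^sup>2"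
    using A_opnorm_upper[OF pos bplus K1, of z]
      A_opnorm_upper[OF pos bminus K2, of z]
    by (simp_all add: z1 power_mono A_seminorm_nonneg[OF pos])
  have max_bound: "p + q \<le> 4 * (w - 1 / 4 * (c + d + \<bar>a - b + c - d\<bar>))"
    if "p \<le> a" "q \<le> b" "a + c \<le> 2 * w" "b + d \<le> 2 * w" for p q a b c d w :: real
    using that by (simp add: abs_if field_simps)
  \<comment> \<open>The parallelogram law is used twice: for S z and S' z, whose sum and difference
    have the seminorms of 2 P z and 2 Q z, and then for P z and Q z.\<close>
  have "A_seminorm A (S' z) = A_seminorm A (T z)"
    by (simp add: A_seminorm_def forms)
  moreover have "A_seminorm A (S z + S' z) = 2 * A_seminorm A (P z)"
    "A_seminorm A (S z - S' z) = 2 * A_seminorm A (Q z)"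
    by (simp_all add: PQ A_seminorm_scaleC[OF pos] norm_divide norm_mult)
  ultimately have "(A_seminorm A (T z))\<^sup>2 + (A_seminorm A (S z))\<^sup>2
      = (A_seminorm A (P z + Q z))\<^sup>2 + (A_seminorm A (P z - Q z))\<^sup>2"
    using A_seminorm_parallelogram[OF pos, of "P z" "Q z"]
      A_seminorm_parallelogram[OF pos, of "S z" "S' z"]
    by (simp add: power_mult_distrib)
  then show "(A_seminorm A (T z))\<^sup>2 + (A_seminorm A (S z))\<^sup>2 \<le> 4 * ((A_numradius A T)\<^sup>2 - 1 / 4 *
      ((A_crawford A (\<lambda>z. P z - Q z))\<^sup>2 + (A_crawford A (\<lambda>z. P z + Q z))\<^sup>2
       + \<bar>(A_opnorm A (\<lambda>z. P z + Q z))\<^sup>2 - (A_opnorm A (\<lambda>z. P z - Q z))\<^sup>2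
          + (A_crawford A (\<lambda>z. P z - Q z))\<^sup>2 - (A_crawford A (\<lambda>z. P z + Q z))\<^sup>2\<bar>))"
    by (rule order_trans[OF eq_refl max_bound[OF le plus minus]])
qed

lemma A_inner_products_le:
  assumes T1: "\<And>x y. A_inner A (T1 x) y = A_inner A x (S1 y)"
    and T2: "T2 \<in> A_adjointable A" and X: "X \<in> A_adjointable A" and Y: "Y \<in> A_adjointable A"
    and z: "z \<in> A_unit A"
  shows "cmod (A_inner A (T1 (X (T2 z))) z) + cmod (A_inner A (T2 (Y (T1 z))) z)
    \<le> A_opnorm A T2 * max (A_opnorm A X) (A_opnorm A Y)
        * (A_seminorm A (T1 z) + A_seminorm A (S1 z))"
proof -
  define n m where "n = A_opnorm A T2" and "m = max (A_opnorm A X) (A_opnorm A Y)"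
  note nonneg = A_seminorm_nonneg[OF pos]
  have n0: "n \<ge> 0" unfolding n_def by (rule A_adjointable_opnorm[OF T2])
  have m0: "m \<ge> 0" unfolding m_def using A_adjointable_opnorm(2)[OF X] by simp
  have z1: "A_seminorm A z = 1" using z by (simp add: A_unit_def)
  obtain R2 where R2: "\<And>x y. A_inner A (T2 x) y = A_inner A x (R2 y)"
    using A_adjointableE[OF T2] by metis
  have T2n: "A_seminorm A (T2 x) \<le> n * A_seminorm A x" for x
    unfolding n_def by (rule A_adjointable_opnorm[OF T2])
  \<comment> \<open>\<open>R2\<close> is an arbitrary A-adjoint of \<open>T2\<close>; cancellation
    gives it the same bound as \<open>T2\<close>.\<close>
  have R2z: "A_seminorm A (R2 z) \<le> n"
    using A_seminorm_adjoint_le[OF pos R2 T2n, of z] z1 by simp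
  have Xm: "A_seminorm A (X x) \<le> m * A_seminorm A x"
    and Ym: "A_seminorm A (Y x) \<le> m * A_seminorm A x" for x
    using A_adjointable_opnorm(1)[OF X, of x] A_adjointable_opnorm(1)[OF Y, of x]
      mult_right_mono[OF max.cobounded1[of "A_opnorm A X" "A_opnorm A Y"] nonneg[of x]]
      mult_right_mono[OF max.cobounded2[of "A_opnorm A Y" "A_opnorm A X"] nonneg[of x]]
    unfolding m_def by linarith+
  have "cmod (A_inner A (T1 (X (T2 z))) z) \<le> A_seminorm A (X (T2 z)) * A_seminorm A (S1 z)"
    unfolding T1 by (rule A_cauchy_schwarz[OF pos])
  also have "\<dots> \<le> m * n * A_seminorm A (S1 z)"
    using order_trans[OF Xm mult_left_mono[OF T2n m0], of z] z1
    by (intro mult_right_mono nonneg) simp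
  finally have 1: "cmod (A_inner A (T1 (X (T2 z))) z) \<le> m * n * A_seminorm A (S1 z)" .
  have "cmod (A_inner A (T2 (Y (T1 z))) z) \<le> A_seminorm A (Y (T1 z)) * A_seminorm A (R2 z)"
    unfolding R2 by (rule A_cauchy_schwarz[OF pos])
  also have "\<dots> \<le> m * A_seminorm A (T1 z) * n"
    using m0 nonneg by (intro mult_mono Ym R2z) auto
  finally show ?thesis using 1 unfolding n_def[symmetric] m_def[symmetric]
    by (simp add: algebra_simps)
qed

end

theorem theorem31:
  fixes A T1 T2 X Y P Q :: "'a::chilbert_space \<Rightarrow> 'a" and \<alpha> :: real
  assumes "positive_op A"
    and "T1 \<in> A_adjointable A" and "T2 \<in> A_adjointable A"
    and "X \<in> A_adjointable A" and "Y \<in> A_adjointable A"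
    and P: "P = (\<lambda>z. (1 / 2) *\<^sub>C (A_adjoint A T1 z + A_adjoint A (A_adjoint A T1) z))"
    and Q: "Q = (\<lambda>z. (1 / (2 * \<i>)) *\<^sub>C (A_adjoint A T1 z - A_adjoint A (A_adjoint A T1) z))"
    and \<alpha>: "\<alpha> = sqrt ((A_numradius A T1)\<^sup>2 - 1 / 4 *
      ((A_crawford A (\<lambda>z. P z - Q z))\<^sup>2 + (A_crawford A (\<lambda>z. P z + Q z))\<^sup>2
       + \<bar>(A_opnorm A (\<lambda>z. P z + Q z))\<^sup>2 - (A_opnorm A (\<lambda>z. P z - Q z))\<^sup>2
          + (A_crawford A (\<lambda>z. P z - Q z))\<^sup>2 - (A_crawford A (\<lambda>z. P z + Q z))\<^sup>2\<bar>))"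
  shows "A_numradius A (\<lambda>z. T1 (X (T2 z)) + T2 (Y (T1 z)))
           \<le> 2 * sqrt 2 * A_opnorm A T2 * max (A_opnorm A X) (A_opnorm A Y) * \<alpha>
       \<and> A_numradius A (\<lambda>z. T1 (X (T2 z)) - T2 (Y (T1 z)))
           \<le> 2 * sqrt 2 * A_opnorm A T2 * max (A_opnorm A X) (A_opnorm A Y) * \<alpha>"
proof -
  note pos = \<open>positive_op A\<close>
  define S where "S = A_adjoint A T1"
  define F :: "real \<Rightarrow> real" where
    "F = (\<lambda>a. 2 * sqrt 2 * A_opnorm A T2 * max (A_opnorm A X) (A_opnorm A Y) * a)"
  have bound: "cmod (A_inner A (T1 (X (T2 z))) z) + cmod (A_inner A (T2 (Y (T1 z))) z) \<le> F \<alpha>"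
    if z: "z \<in> A_unit A" for z
  proof -
    let ?s = "A_seminorm A (T1 z)" and ?t = "A_seminorm A (S z)"
    note cart = A_seminorm_cartesian_bound[OF pos S_def P[folded S_def] Q[folded S_def] assms(2) z]
    obtain E where E: "\<alpha> = sqrt E" "?s\<^sup>2 + ?t\<^sup>2 \<le> 4 * E"
      using \<alpha> cart(1) by blast
    \<comment> \<open>HOL extends \<open>sqrt\<close> to negative numbers with negative values. Here
      \<open>E\<close> is nonnegative because 4 E dominates a sum of squares at one A-unit
      vector.\<close>
    then have "E \<ge> 0" using sum_power2_ge_zero[of ?s ?t] by linarith
    then have "\<alpha> \<ge> 0" and sq: "?s\<^sup>2 + ?t\<^sup>2 \<le> 4 * \<alpha>\<^sup>2"
      using E by simp_all
    have "?s + ?t \<le> 2 * sqrt 2 * \<alpha>"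
    proof (rule power2_le_imp_le)
      \<comment> \<open>Together with \<open>sq\<close> this gives (s + t)^2 \<le> 8 \<alpha>^2, the
        origin of the constant 2 sqrt 2.\<close>
      have "(?s + ?t)\<^sup>2 \<le> 2 * (?s\<^sup>2 + ?t\<^sup>2)"
        using zero_le_power2[of "?s - ?t"] by (simp add: power2_sum power2_diff)
      with sq show "(?s + ?t)\<^sup>2 \<le> (2 * sqrt 2 * \<alpha>)\<^sup>2"
        by (simp add: power_mult_distrib)
    qed (use \<open>\<alpha> \<ge> 0\<close> in simp)
    moreover have "0 \<le> A_opnorm A T2 * max (A_opnorm A X) (A_opnorm A Y)"
      using A_adjointable_opnorm(2)[OF pos] assms by (simp add: le_max_iff_disj)
    ultimately have "A_opnorm A T2 * max (A_opnorm A X) (A_opnorm A Y) * (?s + ?t)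
        \<le> A_opnorm A T2 * max (A_opnorm A X) (A_opnorm A Y) * (2 * sqrt 2 * \<alpha>)"
      by (rule mult_left_mono)
    also have "\<dots> = F \<alpha>" by (simp only: F_def mult_ac)
    finally have "A_opnorm A T2 * max (A_opnorm A X) (A_opnorm A Y) * (?s + ?t) \<le> F \<alpha>" .
    then show ?thesis
      using A_inner_products_le[OF pos cart(2) assms(3-5) z] by linarith
  qed
  have "A_numradius A (\<lambda>z. T1 (X (T2 z)) + T2 (Y (T1 z))) \<le> F \<alpha>
      \<and> A_numradius A (\<lambda>z. T1 (X (T2 z)) - T2 (Y (T1 z))) \<le> F \<alpha>"
  proof (cases "A_unit A = {}")
    \<comment> \<open>Without A-unit vectors both sides are 0 by the default values: the factor
      \<open>A_opnorm A T2\<close> annihilates the right-hand side.\<close>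
    case True
    then show ?thesis by (simp add: A_numradius_def A_opnorm_def F_def)
  next
    case False
    \<comment> \<open>The triangle inequality ignores the sign, so one bound on the sum of the
      moduli serves both operators.\<close>
    have "cmod (A_inner A (T1 (X (T2 z)) + T2 (Y (T1 z))) z) \<le> F \<alpha>"
      "cmod (A_inner A (T1 (X (T2 z)) - T2 (Y (T1 z))) z) \<le> F \<alpha>" if "z \<in> A_unit A" for z
      using bound[OF that] unfolding A_inner_simps[OF pos]
      by (blast intro: order_trans[OF norm_triangle_ineq] order_trans[OF norm_triangle_ineq4])+
    then show ?thesis
      using False by (auto simp: A_numradius_def intro!: cSUP_least)
  qed
  then show ?thesis unfolding F_def .
qed

end
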